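(* Let $\rho_e(x),u_e(x),P_e(x),P_{2e}(x),R_e(x)$ be any equilibrium configuration of one of the two types (I), (II) described in the context. Then the dimensionless bubbly fluid model given in the context admits a family of time-dependent exact solutions given by $$\rho=\rho_e(x-ct),\quad u=u_e(x-ct)+c,\quad P=P_e(x-ct),\quad P_2=P_{2e}(x-ct),\quad R=R_e(x-ct)$$ for an arbitrary constant $c$.
   Context: The dimensionless one-dimensional bubbly fluid model, for the unknown fields $\rho$ (mixture density), $u$ (mixture velocity), $P$ (mixture pressure), $P_2$ (gas pressure in the bubbles), $R$ (bubble radius), functions of $(x,t)$, is $$\rho_t+(\rho u)_x=0,$$ $$(\rho u)_t+(\rho u^2+P)_x-u_{xx}+\kappa\rho=0,$$ $$P=P_2-\left(R\,\mathcal{D}_t^2R+\tfrac32(\mathcal{D}_tR)^2+\tfrac43\frac{\mathcal{D}_tR}{R}\right),$$ $$\mathcal{D}_tP_2+3\gamma P_2\frac{\mathcal{D}_tR}{R}+3(\gamma-1)\frac{T_0}{R}\left(\frac{P_2}{P_0}\frac{R^3}{R_0^3}-1\right)=0,$$ $$(1-X+R^3)\rho-1=0,$$ where $\mathcal{D}_t=\partial_t+u\,\partial_x$ is the material derivative. The dimensionless constants are the gas mass fraction $X$, the adiabatic exponent $\gamma$, and the scaled gravity acceleration $\kappa$; $P_0,T_0,R_0$ denote the initial gas pressure, temperature and bubble radius. The equilibrium configurations considered are: (I) those satisfying, with a constant $K_e$, $$\rho_e=\frac{K_e}{u_e},\quad P_e=P_0+\frac{du_e}{dx}-K_eu_e+\kappa\int\rho_e\,dx,\quad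 P_{2e}=P_0\bigl(K_e(X-1)+u_e\bigr)^{-\gamma},\quad R_e^3=\frac{u_e}{K_e}+X-1$$ together with the ODE $$P_e=P_{2e}-u_e\left(R_e\frac{d^2R_e}{dx^2}+\frac{du_e}{dx}R_e\frac{dR_e}{dx}+\frac32\left(\frac{dR_e}{dx}\right)^2+\frac{4}{3R_e}\frac{dR_e}{dx}\right);$$ (II) those given by $$u_e=0,\quad P_e=P_0+\kappa\int\rho_e\,dx,\quad P_{2e}=P_e,\quad R_e^3=\frac1{\rho_e}+X-1,$$ where $\rho_e(x)$ is an arbitrary equilibrium density distribution.
   Formalization: The printed claim fails. Added: the heat term 3(γ-1)(T0/R_e)(P_2e R_e³/(P0 R0³)-1) vanishes. Corrected: ∫ρ_e dx is taken with derivative -ρ_e, and in the ODE of (I) the terms R_e R_e'' and (3/2)(R_e')² inside the bracket get an extra factor u_e. *)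

theory Defs
  imports "HOL-Analysis.Analysis"
begin

text \<open>Fields are functions of position and time, in this order.\<close>

type_synonym field = "real \<Rightarrow> real \<Rightarrow> real"

definition dx :: "field \<Rightarrow> field" where
  "dx f x t = deriv (\<lambda>y. f y t) x"

definition dt :: "field \<Rightarrow> field" where
  "dt f x t = deriv (\<lambda>s. f x s) t"

definition Dmat :: "field \<Rightarrow> field \<Rightarrow> field" where
  "Dmat u f x t = dt f x t + u x t * dx f x t"

text \<open>
  Since \<^const>\<open>deriv\<close> is total, a classical solution has to require explicitly that the
  derivatives entering the equations exist. Differentiability is meant jointly in position and time.
\<close>

definition diff1_on :: "(real \<times> real) set \<Rightarrow> field \<Rightarrow> bool" where
  "diff1_on \<Omega> f \<longleftrightarrow> (\<forall>p\<in>\<Omega>. (\<lambda>(x, t). f x t) differentiable (at p))"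

definition diff2_on :: "(real \<times> real) set \<Rightarrow> field \<Rightarrow> bool" where
  "diff2_on \<Omega> f \<longleftrightarrow> diff1_on \<Omega> f \<and> diff1_on \<Omega> (dx f) \<and> diff1_on \<Omega> (dt f)"

text \<open>
  Both families of equilibria below satisfy the adiabatic part of the gas energy equation, but their
  formulas alone do not make this heat term vanish (unless, for instance, \<open>\<gamma> = 1\<close>); its
  vanishing is the thermal part of being in equilibrium.
\<close>

definition heat_exchange :: "real \<Rightarrow> real \<Rightarrow> real \<Rightarrow> real \<Rightarrow> real \<Rightarrow> real \<Rightarrow> real" where
  "heat_exchange \<gamma> P0 T0 R0 p r = 3 * (\<gamma> - 1) * (T0 / r) * ((p / P0) * (r ^ 3 / R0 ^ 3) - 1)"

definition bubbly_solution ::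
  "real \<Rightarrow> real \<Rightarrow> real \<Rightarrow> real \<Rightarrow> real \<Rightarrow> real \<Rightarrow> (real \<times> real) set \<Rightarrow>
   field \<Rightarrow> field \<Rightarrow> field \<Rightarrow> field \<Rightarrow> field \<Rightarrow> bool" where
  "bubbly_solution X \<gamma> \<kappa> P0 T0 R0 \<Omega> \<rho> u P P2 R \<longleftrightarrow>
     diff1_on \<Omega> \<rho> \<and> diff2_on \<Omega> u \<and> diff1_on \<Omega> P \<and> diff1_on \<Omega> P2 \<and> diff2_on \<Omega> R \<and>
     (\<forall>(x, t)\<in>\<Omega>.
        R x t > 0 \<and>
        dt \<rho> x t + dx (\<lambda>x t. \<rho> x t * u x t) x t = 0 \<and>
        dt (\<lambda>x t. \<rho> x t * u x t) x t + dx (\<lambda>x t. \<rho> x t * (u x t)\<^sup>2 + P x t) x t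
          - dx (dx u) x t + \<kappa> * \<rho> x t = 0 \<and>
        P x t = P2 x t - (R x t * Dmat u (Dmat u R) x t + 3 / 2 * (Dmat u R x t)\<^sup>2
                          + 4 / 3 * (Dmat u R x t / R x t)) \<and>
        Dmat u P2 x t + 3 * \<gamma> * P2 x t * (Dmat u R x t / R x t)
          + heat_exchange \<gamma> P0 T0 R0 (P2 x t) (R x t) = 0 \<and>
        (1 - X + R x t ^ 3) * \<rho> x t - 1 = 0)"

text \<open>
  The column weight: \<open>F\<close> is an indefinite integral of the density taken from the running point
  upwards to a reference level, so that \<open>F a\<close> exceeds \<open>F b\<close> by the integral of the density over
  the interval from \<open>a\<close> to \<open>b\<close>; its additive constant is free. In the momentum equation the
  term \<open>\<kappa> \<rho>\<close> stands on the left, so gravity acts towards decreasing position and the static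
  balance \<open>P' = - \<kappa> \<rho>\<close> forces this orientation in \<open>P = P0 + \<kappa> F\<close>.
\<close>

definition column_integral :: "real set \<Rightarrow> (real \<Rightarrow> real) \<Rightarrow> (real \<Rightarrow> real) \<Rightarrow> bool" where
  "column_integral J \<rho> F \<longleftrightarrow>
     (\<forall>a\<in>J. \<forall>b\<in>J. a \<le> b \<longrightarrow> (\<rho> has_integral (F a - F b)) {a..b})"

text \<open>
  The flowing equilibria. The last conjunct is the steady form of the bubble equation: along a
  steady flow \<open>D\<^sub>t R = u R'\<close> and hence \<open>D\<^sub>t (D\<^sub>t R) = u (u R'' + u' R')\<close>, which puts
  a factor \<open>u\<close> also on \<open>R R''\<close> and on \<open>(R')\<^sup>2\<close> inside the bracket;
  the source omits these two factors, and without them the fields do not satisfy the bubble equation.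
  Positivity of \<open>K (X - 1) + u\<close> is what the real power needs in order to be meaningful.
\<close>

definition equilibrium_I ::
  "real set \<Rightarrow> real \<Rightarrow> real \<Rightarrow> real \<Rightarrow> real \<Rightarrow> (real \<Rightarrow> real) \<Rightarrow> (real \<Rightarrow> real) \<Rightarrow>
   (real \<Rightarrow> real) \<Rightarrow> (real \<Rightarrow> real) \<Rightarrow> (real \<Rightarrow> real) \<Rightarrow> bool" where
  "equilibrium_I J X \<gamma> \<kappa> P0 \<rho>_e u_e P_e P2_e R_e \<longleftrightarrow>
     (\<exists>K F. K \<noteq> 0 \<and> column_integral J \<rho>_e F \<and>
       (\<forall>x\<in>J.
          u_e differentiable (at x) \<and> deriv u_e differentiable (at x) \<and>
          u_e x \<noteq> 0 \<and> R_e x > 0 \<and> K * (X - 1) + u_e x > 0 \<and>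
          \<rho>_e x = K / u_e x \<and>
          P_e x = P0 + deriv u_e x - K * u_e x + \<kappa> * F x \<and>
          P2_e x = P0 * (K * (X - 1) + u_e x) powr (- \<gamma>) \<and>
          R_e x ^ 3 = u_e x / K + X - 1 \<and>
          P_e x = P2_e x - u_e x * (u_e x * R_e x * deriv (deriv R_e) x
                                 + deriv u_e x * R_e x * deriv R_e x
                                 + 3 / 2 * u_e x * (deriv R_e x)\<^sup>2
                                 + 4 / (3 * R_e x) * deriv R_e x)))"

text \<open>The equilibria at rest, with an arbitrary twice differentiable density distribution.\<close>

definition equilibrium_II ::
  "real set \<Rightarrow> real \<Rightarrow> real \<Rightarrow> real \<Rightarrow> (real \<Rightarrow> real) \<Rightarrow> (real \<Rightarrow> real) \<Rightarrow>
   (real \<Rightarrow> real) \<Rightarrow> (real \<Rightarrow> real) \<Rightarrow> (real \<Rightarrow> real) \<Rightarrow> bool" where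
  "equilibrium_II J X \<kappa> P0 \<rho>_e u_e P_e P2_e R_e \<longleftrightarrow>
     (\<exists>F. column_integral J \<rho>_e F \<and>
       (\<forall>x\<in>J.
          \<rho>_e differentiable (at x) \<and> deriv \<rho>_e differentiable (at x) \<and>
          \<rho>_e x \<noteq> 0 \<and> R_e x > 0 \<and>
          u_e x = 0 \<and>
          P_e x = P0 + \<kappa> * F x \<and>
          P2_e x = P_e x \<and>
          R_e x ^ 3 = 1 / \<rho>_e x + X - 1))"

end

theory Submission
  imports Defs
begin

text \<open>
  The equations are Galilean invariant: on a wave \<open>f (x - c t)\<close> advected by \<open>u_e (x - c t) + c\<close>
  the material derivative acts as \<open>u_e d/dz\<close>, \<open>z = x - c t\<close>, and the powers of \<open>c\<close> in the momentum
  balance multiply the steady mass balance. So only the steady equations have to be verified. For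
  the flowing equilibria the gas equation holds because \<open>K (X - 1) + u_e = K R_e\<^sup>3\<close>, which makes
  \<open>P2_e R_e\<^sup>3\<^sup>\<gamma>\<close> constant.
\<close>

section \<open>Travelling waves and their derivatives\<close>

text \<open>Agreement is asked only where \<open>x - c * t\<close> lies in \<open>J\<close>, because
  nothing is known of a profile outside \<open>J\<close>. The class is stable under
  \<open>dx\<close>, \<open>dt\<close> and \<open>Dmat\<close>, so iterated derivatives of fields
  can be computed on profiles of one variable.\<close>

definition travels :: "real set \<Rightarrow> real \<Rightarrow> field \<Rightarrow> (real \<Rightarrow> real) \<Rightarrow> bool" where
  "travels J c F f \<longleftrightarrow> (\<forall>x t. x - c * t \<in> J \<longrightarrow> F x t = f (x - c * t))"

lemma travelsD: "travels J c F f \<Longrightarrow> x - c * t \<in> J \<Longrightarrow> F x t = f (x - c * t)"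
  by (simp add: travels_def)

lemma travels_wave: "travels J c (\<lambda>x t. f (x - c * t)) f"
  by (simp add: travels_def)

lemma travels_dx:
  assumes "open J" "travels J c F f" "\<forall>z\<in>J. f differentiable (at z)"
  shows "travels J c (dx F) (deriv f)"
  unfolding travels_def dx_def
proof (intro allI impI)
  fix x t assume z: "x - c * t \<in> J"
  have "(f has_real_derivative deriv f (x - c * t)) (at (x - c * t))"
    using assms(3) z by (simp add: DERIV_deriv_iff_real_differentiable)
  then have "((\<lambda>y. f (y - c * t)) has_real_derivative deriv f (x - c * t) * 1) (at x)"
    by (rule DERIV_chain2) (auto intro!: derivative_eq_intros)
  \<comment> \<open>Off this set \<open>F\<close> is unconstrained; since the set is open,
    \<open>F\<close> agrees with the wave on a whole neighbourhood of \<open>x\<close> and inherits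
    its derivative.\<close>
  moreover have "open ((\<lambda>y. y - c * t) -` J)"
    by (intro open_vimage \<open>open J\<close> continuous_intros)
  ultimately have "((\<lambda>y. F y t) has_real_derivative deriv f (x - c * t) * 1) (at x)"
    by (rule has_field_derivative_transform_within_open)
      (use z assms(2) in \<open>auto simp: travels_def\<close>)
  then show "deriv (\<lambda>y. F y t) x = deriv f (x - c * t)"
    by (simp add: DERIV_imp_deriv)
qed

lemma travels_dt:
  assumes "open J" "travels J c F f" "\<forall>z\<in>J. f differentiable (at z)"
  shows "travels J c (dt F) (\<lambda>z. - c * deriv f z)"
  unfolding travels_def dt_def
proof (intro allI impI)
  fix x t assume z: "x - c * t \<in> J"
  have "(f has_real_derivative deriv f (x - c * t)) (at (x - c * t))"
    using assms(3) z by (simp add: DERIV_deriv_iff_real_differentiable)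
  then have "((\<lambda>s. f (x - c * s)) has_real_derivative deriv f (x - c * t) * - c) (at t)"
    by (rule DERIV_chain2) (auto intro!: derivative_eq_intros)
  moreover have "open ((\<lambda>s. x - c * s) -` J)"
    by (intro open_vimage \<open>open J\<close> continuous_intros)
  ultimately have "((\<lambda>s. F x s) has_real_derivative deriv f (x - c * t) * - c) (at t)"
    by (rule has_field_derivative_transform_within_open)
      (use z assms(2) in \<open>auto simp: travels_def\<close>)
  then show "deriv (\<lambda>s. F x s) t = - c * deriv f (x - c * t)"
    by (simp add: DERIV_imp_deriv)
qed

text \<open>The time derivative contributes \<open>- c * deriv f z\<close> and the advection
  \<open>(v z + c) * deriv f z\<close>, so the terms in \<open>c\<close> cancel.\<close>

lemma travels_Dmat:
  assumes "open J" "travels J c U (\<lambda>z. v z + c)" "travels J c F f"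
    and "\<forall>z\<in>J. f differentiable (at z)"
  shows "travels J c (Dmat U F) (\<lambda>z. v z * deriv f z)"
  using travels_dx[OF assms(1,3,4)] travels_dt[OF assms(1,3,4)] assms(2)
  by (simp add: travels_def Dmat_def algebra_simps)

text \<open>Joint differentiability follows from composing the profile with the bounded linear map
  that sends \<open>(x, t)\<close> to \<open>x - c * t\<close>.\<close>

lemma diff1_on_travels:
  assumes "open J" "travels J c F f" "\<forall>z\<in>J. f differentiable (at z)"
  shows "diff1_on {(x, t). x - c * t \<in> J} F"
  unfolding diff1_on_def
proof
  fix p assume p: "p \<in> {(x, t). x - c * t \<in> J}"
  let ?w = "\<lambda>p :: real \<times> real. fst p - c * snd p"
  have \<Omega>: "{(x, t). x - c * t \<in> J} = ?w -` J"
    by auto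
  have "f differentiable (at (?w p))"
    using p assms(3) by (auto split: prod.splits)
  moreover have "?w differentiable (at p)"
    by (intro differentiableI[OF bounded_linear_imp_has_derivative] bounded_linear_intros)
  ultimately have "(\<lambda>p. f (?w p)) differentiable (at p)"
    by (rule differentiable_compose)
  then obtain D where D: "((\<lambda>p. f (?w p)) has_derivative D) (at p)"
    unfolding differentiable_def by blast
  have "open (?w -` J)"
    by (intro open_vimage \<open>open J\<close> continuous_intros)
  then have "((\<lambda>(x, t). F x t) has_derivative D) (at p)"
    by (rule has_derivative_transform_within_open[OF D])
      (use p assms(2) in \<open>auto simp: travels_def split: prod.splits\<close>)
  then show "(\<lambda>(x, t). F x t) differentiable (at p)"
    by (rule differentiableI)
qed

text \<open>\<open>dx F\<close> and \<open>dt F\<close> are again waves, with profiles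
  \<open>deriv f\<close> and \<open>- c * deriv f\<close>, so the first-order result applies to each
  of them.\<close>

lemma diff2_on_travels:
  assumes "open J" "travels J c F f"
    and "\<forall>z\<in>J. f differentiable (at z)" "\<forall>z\<in>J. deriv f differentiable (at z)"
  shows "diff2_on {(x, t). x - c * t \<in> J} F"
  unfolding diff2_on_def
proof (intro conjI)
  have "\<forall>z\<in>J. (\<lambda>z. - c * deriv f z) differentiable (at z)"
    using assms(4) by (intro ballI differentiable_mult) auto
  then show "diff1_on {(x, t). x - c * t \<in> J} (dt F)"
    by (rule diff1_on_travels[OF assms(1) travels_dt[OF assms(1-3)]])
qed (rule diff1_on_travels[OF assms(1-3)],
    rule diff1_on_travels[OF assms(1) travels_dx[OF assms(1-3)] assms(4)])

section \<open>Reduction to the steady equations\<close>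

text \<open>The assumptions are the steady model in the frame moving with speed \<open>c\<close>.
  The steady momentum equation appears in nonconservative form, that is, after subtracting
  \<open>u z\<close> times the mass balance from the conservative one.\<close>

lemma bubbly_solution_boost:
  fixes \<rho> u P P2 R :: "real \<Rightarrow> real"
  assumes J: "open J"
    and \<rho>: "\<forall>z\<in>J. \<rho> differentiable (at z)"
    and u: "\<forall>z\<in>J. u differentiable (at z)"
    and u': "\<forall>z\<in>J. deriv u differentiable (at z)"
    and P: "\<forall>z\<in>J. P differentiable (at z)"
    and P2: "\<forall>z\<in>J. P2 differentiable (at z)"
    and R: "\<forall>z\<in>J. R differentiable (at z)"
    and R': "\<forall>z\<in>J. deriv R differentiable (at z)"
    and pos: "\<forall>z\<in>J. R z > 0"
    and mass: "\<forall>z\<in>J. deriv \<rho> z * u z + \<rho> z * deriv u z = 0"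
    and momentum: "\<forall>z\<in>J.
          \<rho> z * u z * deriv u z + deriv P z - deriv (deriv u) z + \<kappa> * \<rho> z = 0"
    and bubble: "\<forall>z\<in>J.
          P z = P2 z - (R z * (u z * (deriv u z * deriv R z + u z * deriv (deriv R) z))
                        + 3 / 2 * (u z * deriv R z)\<^sup>2 + 4 / 3 * (u z * deriv R z / R z))"
    and gas: "\<forall>z\<in>J.
          u z * deriv P2 z + 3 * \<gamma> * P2 z * (u z * deriv R z / R z)
            + heat_exchange \<gamma> P0 T0 R0 (P2 z) (R z) = 0"
    and volume: "\<forall>z\<in>J. (1 - X + R z ^ 3) * \<rho> z - 1 = 0"
  shows "bubbly_solution X \<gamma> \<kappa> P0 T0 R0 {(x, t). x - c * t \<in> J}
           (\<lambda>x t. \<rho> (x - c * t)) (\<lambda>x t. u (x - c * t) + c) (\<lambda>x t. P (x - c * t))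
           (\<lambda>x t. P2 (x - c * t)) (\<lambda>x t. R (x - c * t))"
proof -
  note has = DERIV_deriv_iff_real_differentiable[THEN iffD2]
  define U :: field where "U = (\<lambda>x t. u (x - c * t) + c)"
  have U: "travels J c U (\<lambda>z. u z + c)"
    by (simp add: travels_def U_def)
  have uc: "\<forall>z\<in>J. (\<lambda>z. u z + c) differentiable (at z)"
    using u by simp
  \<comment> \<open>The constant cancels already in the difference quotient, so this is an equality
    of functions that needs no differentiability and can be rewritten under a further
    \<open>deriv\<close>.\<close>
  have duc: "deriv (\<lambda>z. u z + c) = deriv u"
    by (simp add: fun_eq_iff deriv_def field_differentiable_def DERIV_def)
  have ddU: "travels J c (dx (dx U)) (deriv (deriv u))"
    using travels_dx[OF J travels_dx[OF J U uc]] u' by (simp add: duc)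
  have flux: "((\<lambda>z. \<rho> z * (u z + c)) has_real_derivative
      deriv \<rho> z * (u z + c) + \<rho> z * deriv u z) (at z)" if "z \<in> J" for z
    using has[OF bspec[OF \<rho> that]] has[OF bspec[OF u that]] by (auto intro!: derivative_eq_intros)
  have mflux: "((\<lambda>z. \<rho> z * (u z + c)\<^sup>2 + P z) has_real_derivative
      deriv \<rho> z * (u z + c)\<^sup>2 + \<rho> z * (2 * (u z + c) * deriv u z) + deriv P z) (at z)"
    if "z \<in> J" for z
    using has[OF bspec[OF \<rho> that]] has[OF bspec[OF u that]] has[OF bspec[OF P that]]
    by (auto intro!: derivative_eq_intros)
  have uR': "((\<lambda>z. u z * deriv R z) has_real_derivative
      deriv u z * deriv R z + u z * deriv (deriv R) z) (at z)" if "z \<in> J" for z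
    using has[OF bspec[OF u that]] has[OF bspec[OF R' that]] by (auto intro!: derivative_eq_intros)
  have flux_wave: "travels J c (\<lambda>x t. \<rho> (x - c * t) * U x t) (\<lambda>z. \<rho> z * (u z + c))"
    and mflux_wave: "travels J c (\<lambda>x t. \<rho> (x - c * t) * (U x t)\<^sup>2 + P (x - c * t))
      (\<lambda>z. \<rho> z * (u z + c)\<^sup>2 + P z)"
    by (simp_all add: travels_def U_def)
  have DR: "travels J c (Dmat U (\<lambda>x t. R (x - c * t))) (\<lambda>z. u z * deriv R z)"
    by (rule travels_Dmat[OF J U travels_wave R])
  \<comment> \<open>The first material derivative is itself a wave with profile
    \<open>u z * deriv R z\<close>; the product rule \<open>uR'\<close> makes that profile
    differentiable, so the rule applies a second time.\<close>
  have DDR: "travels J c (Dmat U (Dmat U (\<lambda>x t. R (x - c * t))))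
      (\<lambda>z. u z * deriv (\<lambda>z. u z * deriv R z) z)"
    by (rule travels_Dmat[OF J U DR]) (use uR' in \<open>unfold real_differentiable_def, blast\<close>)
  have DP2: "travels J c (Dmat U (\<lambda>x t. P2 (x - c * t))) (\<lambda>z. u z * deriv P2 z)"
    by (rule travels_Dmat[OF J U travels_wave P2])
  have dt\<rho>: "travels J c (dt (\<lambda>x t. \<rho> (x - c * t))) (\<lambda>z. - c * deriv \<rho> z)"
    by (rule travels_dt[OF J travels_wave \<rho>])
  have dflux: "travels J c (dx (\<lambda>x t. \<rho> (x - c * t) * U x t)) (deriv (\<lambda>z. \<rho> z * (u z + c)))"
    and dtflux: "travels J c (dt (\<lambda>x t. \<rho> (x - c * t) * U x t))
      (\<lambda>z. - c * deriv (\<lambda>z. \<rho> z * (u z + c)) z)"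
    by (intro travels_dx travels_dt J flux_wave; use flux in \<open>unfold real_differentiable_def, blast\<close>)+
  have dmflux: "travels J c (dx (\<lambda>x t. \<rho> (x - c * t) * (U x t)\<^sup>2 + P (x - c * t)))
      (deriv (\<lambda>z. \<rho> z * (u z + c)\<^sup>2 + P z))"
    by (intro travels_dx J mflux_wave) (use mflux in \<open>unfold real_differentiable_def, blast\<close>)
  \<comment> \<open>Naming the phase \<open>z\<close> turns every field value into a profile value
    at one point, and each equation becomes an algebraic relation there.\<close>
  have pointwise: "R z > 0 \<and>
      dt (\<lambda>x t. \<rho> (x - c * t)) x t + dx (\<lambda>x t. \<rho> (x - c * t) * U x t) x t = 0 \<and>
      dt (\<lambda>x t. \<rho> (x - c * t) * U x t) x t
        + dx (\<lambda>x t. \<rho> (x - c * t) * (U x t)\<^sup>2 + P (x - c * t)) x t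
        - dx (dx U) x t + \<kappa> * \<rho> z = 0 \<and>
      P z = P2 z - (R z * Dmat U (Dmat U (\<lambda>x t. R (x - c * t))) x t
        + 3 / 2 * (Dmat U (\<lambda>x t. R (x - c * t)) x t)\<^sup>2
        + 4 / 3 * (Dmat U (\<lambda>x t. R (x - c * t)) x t / R z)) \<and>
      Dmat U (\<lambda>x t. P2 (x - c * t)) x t
        + 3 * \<gamma> * P2 z * (Dmat U (\<lambda>x t. R (x - c * t)) x t / R z)
        + heat_exchange \<gamma> P0 T0 R0 (P2 z) (R z) = 0 \<and>
      (1 - X + R z ^ 3) * \<rho> z - 1 = 0"
    if z: "z \<in> J" and zdef: "z = x - c * t" for x t z
  proof (intro conjI)
    note at = z[unfolded zdef]
    show "R z > 0" "(1 - X + R z ^ 3) * \<rho> z - 1 = 0"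
      using pos volume z by auto
    \<comment> \<open>The contributions \<open>- c * deriv \<rho> z\<close> and
      \<open>c * deriv \<rho> z\<close> cancel, leaving the steady mass balance.\<close>
    show "dt (\<lambda>x t. \<rho> (x - c * t)) x t + dx (\<lambda>x t. \<rho> (x - c * t) * U x t) x t = 0"
      using bspec[OF mass z]
      unfolding travelsD[OF dt\<rho> at] travelsD[OF dflux at] zdef[symmetric] DERIV_imp_deriv[OF flux[OF z]]
      by algebra
    \<comment> \<open>Expanded, the left side is that of the steady momentum equation plus
      \<open>u z + c\<close> times that of the steady mass balance.\<close>
    show "dt (\<lambda>x t. \<rho> (x - c * t) * U x t) x t
        + dx (\<lambda>x t. \<rho> (x - c * t) * (U x t)\<^sup>2 + P (x - c * t)) x t
        - dx (dx U) x t + \<kappa> * \<rho> z = 0"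
      using bspec[OF mass z] bspec[OF momentum z]
      unfolding travelsD[OF dtflux at] travelsD[OF dmflux at] travelsD[OF ddU at] zdef[symmetric]
        DERIV_imp_deriv[OF flux[OF z]] DERIV_imp_deriv[OF mflux[OF z]]
      by algebra
    show "P z = P2 z - (R z * Dmat U (Dmat U (\<lambda>x t. R (x - c * t))) x t
        + 3 / 2 * (Dmat U (\<lambda>x t. R (x - c * t)) x t)\<^sup>2
        + 4 / 3 * (Dmat U (\<lambda>x t. R (x - c * t)) x t / R z))"
      unfolding travelsD[OF DDR at] travelsD[OF DR at] zdef[symmetric] DERIV_imp_deriv[OF uR'[OF z]]
      by (rule bspec[OF bubble z])
    show "Dmat U (\<lambda>x t. P2 (x - c * t)) x t
        + 3 * \<gamma> * P2 z * (Dmat U (\<lambda>x t. R (x - c * t)) x t / R z)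
        + heat_exchange \<gamma> P0 T0 R0 (P2 z) (R z) = 0"
      unfolding travelsD[OF DP2 at] travelsD[OF DR at] zdef[symmetric]
      by (rule bspec[OF gas z])
  qed
  have "diff2_on {(x, t). x - c * t \<in> J} U"
    using diff2_on_travels[OF J U uc] u' by (simp add: duc)
  then show ?thesis
    unfolding bubbly_solution_def U_def[symmetric]
    using pointwise diff1_on_travels[OF J travels_wave \<rho>] diff1_on_travels[OF J travels_wave P]
      diff1_on_travels[OF J travels_wave P2] diff2_on_travels[OF J travels_wave R R']
    by auto
qed

section \<open>Regularity of the column weight and the bubble radius\<close>

text \<open>On a small interval around \<open>x\<close>, \<open>F y\<close> is the constant
  \<open>F (x - e)\<close> minus the integral of \<open>\<rho>\<close> from \<open>x - e\<close> to
  \<open>y\<close>. The fundamental theorem of calculus then gives the derivative; the minus sign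
  reflects that the column is measured upwards from the running point.\<close>

lemma column_integral_has_real_derivative:
  assumes "open J" "column_integral J \<rho> F" "continuous_on J \<rho>" "x \<in> J"
  shows "(F has_real_derivative - \<rho> x) (at x)"
proof -
  obtain e where e: "e > 0" "cball x e \<subseteq> J"
    using assms open_contains_cball by blast
  then have sub: "{x - e..x + e} \<subseteq> J"
    by (simp add: cball_eq_atLeastAtMost)
  have "((\<lambda>y. integral {x - e..y} \<rho>) has_real_derivative \<rho> x) (at x within {x - e..x + e})"
    using integral_has_real_derivative continuous_on_subset[OF assms(3) sub] e by auto
  then have *: "((\<lambda>y. F (x - e) - integral {x - e..y} \<rho>) has_real_derivative - \<rho> x) (at x)"
    using e by (auto intro!: derivative_eq_intros simp: at_within_Icc_at)
  have "integral {x - e..y} \<rho> = F (x - e) - F y" if "y \<in> {x - e<..<x + e}" for y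
    by (rule integral_unique)
      (use assms(2) sub that e in \<open>simp add: column_integral_def subset_iff\<close>)
  then have "F (x - e) - integral {x - e..y} \<rho> = F y" if "y \<in> {x - e<..<x + e}" for y
    using that by simp
  then show ?thesis
    by (intro has_field_derivative_transform_within_open[OF *, of "{x - e<..<x + e}"])
      (use e in auto)
qed

text \<open>Differentiability of \<open>R\<close> is derived, not assumed: positivity makes
  \<open>R\<close> the cube root of \<open>g\<close>, and the cube root is smooth at the positive
  value \<open>g z\<close>.\<close>

lemma deriv_cube:
  fixes R :: "real \<Rightarrow> real"
  assumes "open J" "\<forall>z\<in>J. R z > 0"
    and "\<forall>z\<in>J. R z ^ 3 = g z" "\<forall>z\<in>J. g differentiable (at z)" "z \<in> J"
  shows "(R has_real_derivative deriv g z / (3 * (R z)\<^sup>2)) (at z)"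
proof -
  have g: "(g has_real_derivative deriv g z) (at z)"
    using assms(4,5) by (simp add: DERIV_deriv_iff_real_differentiable)
  have root: "root 3 (g y) = R y" if "y \<in> J" for y
    using bspec[OF assms(2) that] bspec[OF assms(3) that]
    by (metis real_root_power_cancel less_imp_le zero_less_numeral)
  have "g z > 0"
    using assms(2,3,5) by (metis zero_less_power)
  \<comment> \<open>Replacing \<open>root 3 (g z)\<close> by \<open>R z\<close> brings the chain
    rule for the cube root into the stated form.\<close>
  then have "((\<lambda>z. root 3 (g z)) has_real_derivative deriv g z / (3 * (R z)\<^sup>2)) (at z)"
    using g root[OF \<open>z \<in> J\<close>] DERIV_chain2[of "root 3" _ g, OF DERIV_real_root g]
    by (simp add: field_simps eval_nat_numeral)
  then show ?thesis
    by (rule has_field_derivative_transform_within_open[OF _ \<open>open J\<close> \<open>z \<in> J\<close> root])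
qed

text \<open>The formula for the first derivative holds throughout the open set \<open>J\<close>, and
  its right side is a quotient of functions differentiable at \<open>z\<close> with nonzero
  denominator.\<close>

lemma deriv2_cube:
  fixes R :: "real \<Rightarrow> real"
  assumes "open J" "\<forall>z\<in>J. R z > 0"
    and "\<forall>z\<in>J. R z ^ 3 = g z" "\<forall>z\<in>J. g differentiable (at z)"
    and "deriv g differentiable (at z)" "z \<in> J"
  shows "deriv R differentiable (at z)"
proof -
  note R = deriv_cube[OF assms(1-4)]
  have "R differentiable (at z)"
    using R[OF \<open>z \<in> J\<close>] by (auto simp: real_differentiable_def)
  then have "(\<lambda>z. deriv g z / (3 * (R z)\<^sup>2)) differentiable (at z)"
    using bspec[OF assms(2) \<open>z \<in> J\<close>] assms(5) by (intro derivative_intros) auto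
  then obtain D where D: "((\<lambda>z. deriv g z / (3 * (R z)\<^sup>2)) has_real_derivative D) (at z)"
    by (auto simp: real_differentiable_def)
  have "(deriv R has_real_derivative D) (at z)"
    by (rule has_field_derivative_transform_within_open[OF D \<open>open J\<close> \<open>z \<in> J\<close>])
      (simp add: DERIV_imp_deriv[OF R])
  then show ?thesis
    by (auto simp: real_differentiable_def)
qed

text \<open>The equilibrium formulas are identities on \<open>J\<close> only; openness allows
  differentiating the formula in place of the field.\<close>

lemma has_real_derivative_eq_on:
  assumes "open J" "z \<in> J" "\<forall>y\<in>J. f y = g y"
    and "(g has_real_derivative D) (at z)"
  shows "(f has_real_derivative D) (at z)"
  by (rule has_field_derivative_transform_within_open[OF assms(4,1,2)]) (simp add: assms(3))

section \<open>The flowing equilibria\<close>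

lemma equilibrium_I_boost:
  assumes J: "open J" and eq: "equilibrium_I J X \<gamma> \<kappa> P0 \<rho> u P P2 R"
    and heat: "\<forall>z\<in>J. heat_exchange \<gamma> P0 T0 R0 (P2 z) (R z) = 0"
  shows "bubbly_solution X \<gamma> \<kappa> P0 T0 R0 {(x, t). x - c * t \<in> J}
           (\<lambda>x t. \<rho> (x - c * t)) (\<lambda>x t. u (x - c * t) + c) (\<lambda>x t. P (x - c * t))
           (\<lambda>x t. P2 (x - c * t)) (\<lambda>x t. R (x - c * t))"
proof -
  obtain K F where K: "K \<noteq> 0" and F: "column_integral J \<rho> F"
    and u: "\<forall>z\<in>J. u differentiable (at z)"
    and u': "\<forall>z\<in>J. deriv u differentiable (at z)"
    and u0: "\<forall>z\<in>J. u z \<noteq> 0"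
    and R0: "\<forall>z\<in>J. R z > 0"
    and w0: "\<forall>z\<in>J. K * (X - 1) + u z > 0"
    and \<rho>: "\<forall>z\<in>J. \<rho> z = K / u z"
    and P: "\<forall>z\<in>J. P z = P0 + deriv u z - K * u z + \<kappa> * F z"
    and P2: "\<forall>z\<in>J. P2 z = P0 * (K * (X - 1) + u z) powr (- \<gamma>)"
    and R3: "\<forall>z\<in>J. R z ^ 3 = u z / K + X - 1"
    and bubble: "\<forall>z\<in>J. P z = P2 z - u z * (u z * R z * deriv (deriv R) z
        + deriv u z * R z * deriv R z + 3 / 2 * u z * (deriv R z)\<^sup>2 + 4 / (3 * R z) * deriv R z)"
    using eq unfolding equilibrium_I_def by blast
  have Du: "(u has_real_derivative deriv u z) (at z)" if "z \<in> J" for z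
    using bspec[OF u that] by (simp add: DERIV_deriv_iff_real_differentiable)
  have Ddu: "(deriv u has_real_derivative deriv (deriv u) z) (at z)" if "z \<in> J" for z
    using bspec[OF u' that] by (simp add: DERIV_deriv_iff_real_differentiable)
  have D\<rho>: "(\<rho> has_real_derivative - K * deriv u z / (u z)\<^sup>2) (at z)" if "z \<in> J" for z
    by (rule has_real_derivative_eq_on[OF J that \<rho>])
      (use Du[OF that] bspec[OF u0 that] in
        \<open>auto intro!: derivative_eq_intros simp: power2_eq_square\<close>)
  have "continuous_on J \<rho>"
    using D\<rho> by (meson DERIV_isCont continuous_at_imp_continuous_on)
  then have DF: "(F has_real_derivative - \<rho> z) (at z)" if "z \<in> J" for z
    by (rule column_integral_has_real_derivative[OF J F _ that])
  have DP: "(P has_real_derivative deriv (deriv u) z - K * deriv u z - \<kappa> * \<rho> z) (at z)"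
    if "z \<in> J" for z
    by (rule has_real_derivative_eq_on[OF J that P])
      (use Du[OF that] Ddu[OF that] DF[OF that] in \<open>auto intro!: derivative_eq_intros\<close>)
  \<comment> \<open>Differentiating the power lowers its exponent by one; splitting off that factor
    of the base with \<open>powr_diff\<close> restores \<open>P2 z\<close> itself.\<close>
  have DP2: "(P2 has_real_derivative - \<gamma> * P2 z * deriv u z / (K * (X - 1) + u z)) (at z)"
    if "z \<in> J" for z
    by (rule has_real_derivative_eq_on[OF J that P2])
      (use Du[OF that] bspec[OF w0 that] bspec[OF P2 that] in
        \<open>auto intro!: derivative_eq_intros simp: powr_diff\<close>)
  have g: "((\<lambda>z. u z / K + X - 1) has_real_derivative deriv u z / K) (at z)" if "z \<in> J" for z
    using Du[OF that] K by (auto intro!: derivative_eq_intros)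
  then have gd: "\<forall>z\<in>J. (\<lambda>z. u z / K + X - 1) differentiable (at z)"
    by (auto simp: real_differentiable_def)
  have dg: "\<forall>z\<in>J. deriv (\<lambda>z. u z / K + X - 1) z = deriv u z / K"
    using DERIV_imp_deriv[OF g] by blast
  have "(deriv (\<lambda>z. u z / K + X - 1) has_real_derivative deriv (deriv u) z / K) (at z)"
    if "z \<in> J" for z
    by (rule has_real_derivative_eq_on[OF J that dg])
      (use Ddu[OF that] K in \<open>auto intro!: derivative_eq_intros\<close>)
  then have gd': "deriv (\<lambda>z. u z / K + X - 1) differentiable (at z)" if "z \<in> J" for z
    using that by (auto simp: real_differentiable_def)
  have DR: "(R has_real_derivative deriv u z / K / (3 * (R z)\<^sup>2)) (at z)" if "z \<in> J" for z
    using deriv_cube[OF J R0 R3 gd that] DERIV_imp_deriv[OF g[OF that]] by simp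
  show ?thesis
  proof (intro bubbly_solution_boost[OF J] ballI)
    fix z assume z: "z \<in> J"
    show "\<rho> differentiable (at z)" "u differentiable (at z)" "deriv u differentiable (at z)"
      "P differentiable (at z)" "P2 differentiable (at z)" "R differentiable (at z)"
      using D\<rho>[OF z] bspec[OF u z] bspec[OF u' z] DP[OF z] DP2[OF z] DR[OF z]
      by (auto simp: real_differentiable_def)
    show "deriv R differentiable (at z)"
      by (rule deriv2_cube[OF J R0 R3 gd gd'[OF z] z])
    show "R z > 0"
      by (rule bspec[OF R0 z])
    show "deriv \<rho> z * u z + \<rho> z * deriv u z = 0"
      unfolding bspec[OF \<rho> z] DERIV_imp_deriv[OF D\<rho>[OF z]]
      using bspec[OF u0 z] by (simp add: power2_eq_square)
    \<comment> \<open>The mass flux \<open>\<rho> z * u z\<close> equals \<open>K\<close>, so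
      inertia cancels the term \<open>- K * deriv u z\<close> of the pressure gradient, while
      viscosity and gravity cancel its other two terms.\<close>
    show "\<rho> z * u z * deriv u z + deriv P z - deriv (deriv u) z + \<kappa> * \<rho> z = 0"
      using bspec[OF \<rho> z] bspec[OF u0 z] DERIV_imp_deriv[OF DP[OF z]] by simp
    show "P z = P2 z - (R z * (u z * (deriv u z * deriv R z + u z * deriv (deriv R) z))
        + 3 / 2 * (u z * deriv R z)\<^sup>2 + 4 / 3 * (u z * deriv R z / R z))"
      by (subst bspec[OF bubble z]) (simp add: algebra_simps power2_eq_square)
    \<comment> \<open>The base of the power in \<open>P2\<close> is a constant multiple of the cubed
      radius, which is the adiabatic law in disguise.\<close>
    have w: "K * (X - 1) + u z = K * R z ^ 3"
      using K bspec[OF R3 z] by (simp add: field_simps)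
    \<comment> \<open>With \<open>deriv R z = deriv u z / (3 * K * (R z)\<^sup>2)\<close>, the
      quotient \<open>deriv u z / (K * R z ^ 3)\<close> is \<open>3 * deriv R z / R z\<close>. This
      cancels the compression term of the gas equation, and \<open>heat\<close> removes the
      rest.\<close>
    have "deriv P2 z = - 3 * \<gamma> * P2 z * (deriv R z / R z)"
      unfolding DERIV_imp_deriv[OF DP2[OF z]] DERIV_imp_deriv[OF DR[OF z]] w
      using K bspec[OF R0 z] by (simp add: field_simps eval_nat_numeral)
    then show "u z * deriv P2 z + 3 * \<gamma> * P2 z * (u z * deriv R z / R z)
        + heat_exchange \<gamma> P0 T0 R0 (P2 z) (R z) = 0"
      by (simp add: bspec[OF heat z])
    \<comment> \<open>The bracket equals \<open>u z / K\<close>, the reciprocal of the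
      density.\<close>
    show "(1 - X + R z ^ 3) * \<rho> z - 1 = 0"
      unfolding bspec[OF R3 z] bspec[OF \<rho> z] using bspec[OF u0 z] K by simp
  qed
qed

section \<open>The equilibria at rest\<close>

text \<open>Without flow the momentum equation is the hydrostatic balance
  \<open>deriv P z = - \<kappa> * \<rho> z\<close>, the bubble equation is
  \<open>P z = P2 z\<close>, and the gas equation is the vanishing of the heat term. The remaining
  work is regularity: \<open>R\<close> inherits two derivatives from the density through its
  cube.\<close>

lemma equilibrium_II_boost:
  assumes J: "open J" and eq: "equilibrium_II J X \<kappa> P0 \<rho> u P P2 R"
    and heat: "\<forall>z\<in>J. heat_exchange \<gamma> P0 T0 R0 (P2 z) (R z) = 0"
  shows "bubbly_solution X \<gamma> \<kappa> P0 T0 R0 {(x, t). x - c * t \<in> J}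
           (\<lambda>x t. \<rho> (x - c * t)) (\<lambda>x t. u (x - c * t) + c) (\<lambda>x t. P (x - c * t))
           (\<lambda>x t. P2 (x - c * t)) (\<lambda>x t. R (x - c * t))"
proof -
  obtain F where F: "column_integral J \<rho> F"
    and \<rho>: "\<forall>z\<in>J. \<rho> differentiable (at z)"
    and \<rho>': "\<forall>z\<in>J. deriv \<rho> differentiable (at z)"
    and \<rho>0: "\<forall>z\<in>J. \<rho> z \<noteq> 0"
    and R0: "\<forall>z\<in>J. R z > 0"
    and u: "\<forall>z\<in>J. u z = 0"
    and P: "\<forall>z\<in>J. P z = P0 + \<kappa> * F z"
    and P2: "\<forall>z\<in>J. P2 z = P z"
    and R3: "\<forall>z\<in>J. R z ^ 3 = 1 / \<rho> z + X - 1"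
    using eq unfolding equilibrium_II_def by blast
  have D\<rho>: "(\<rho> has_real_derivative deriv \<rho> z) (at z)" if "z \<in> J" for z
    using bspec[OF \<rho> that] by (simp add: DERIV_deriv_iff_real_differentiable)
  have "continuous_on J \<rho>"
    using D\<rho> by (meson DERIV_isCont continuous_at_imp_continuous_on)
  then have DF: "(F has_real_derivative - \<rho> z) (at z)" if "z \<in> J" for z
    by (rule column_integral_has_real_derivative[OF J F _ that])
  have DP: "(P has_real_derivative - \<kappa> * \<rho> z) (at z)" if "z \<in> J" for z
    by (rule has_real_derivative_eq_on[OF J that P])
      (use DF[OF that] in \<open>auto intro!: derivative_eq_intros\<close>)
  have DP2: "(P2 has_real_derivative - \<kappa> * \<rho> z) (at z)" if "z \<in> J" for z
    by (rule has_real_derivative_eq_on[OF J that P2 DP[OF that]])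
  \<comment> \<open>The velocity vanishes on \<open>J\<close> only, so its first and second
    derivatives are found there by comparison with the zero function on an open set.\<close>
  have Du: "(u has_real_derivative 0) (at z)" if "z \<in> J" for z
    by (rule has_real_derivative_eq_on[OF J that u DERIV_const])
  then have "\<forall>z\<in>J. deriv u z = 0"
    using DERIV_imp_deriv by blast
  then have Ddu: "(deriv u has_real_derivative 0) (at z)" if "z \<in> J" for z
    by (rule has_real_derivative_eq_on[OF J that _ DERIV_const])
  have g: "((\<lambda>z. 1 / \<rho> z + X - 1) has_real_derivative - deriv \<rho> z / (\<rho> z)\<^sup>2) (at z)"
    if "z \<in> J" for z
    using D\<rho>[OF that] bspec[OF \<rho>0 that] by (auto intro!: derivative_eq_intros simp: power2_eq_square)
  then have gd: "\<forall>z\<in>J. (\<lambda>z. 1 / \<rho> z + X - 1) differentiable (at z)"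
    by (auto simp: real_differentiable_def)
  have dg: "\<forall>z\<in>J. deriv (\<lambda>z. 1 / \<rho> z + X - 1) z = - deriv \<rho> z / (\<rho> z)\<^sup>2"
    using DERIV_imp_deriv[OF g] by blast
  have gd': "deriv (\<lambda>z. 1 / \<rho> z + X - 1) differentiable (at z)" if "z \<in> J" for z
  proof -
    have "(\<lambda>z. - deriv \<rho> z / (\<rho> z)\<^sup>2) differentiable (at z)"
      using bspec[OF \<rho> that] bspec[OF \<rho>' that] bspec[OF \<rho>0 that]
      by (intro derivative_intros) auto
    then obtain D where "((\<lambda>z. - deriv \<rho> z / (\<rho> z)\<^sup>2) has_real_derivative D) (at z)"
      by (auto simp: real_differentiable_def)
    then have "(deriv (\<lambda>z. 1 / \<rho> z + X - 1) has_real_derivative D) (at z)"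
      by (rule has_real_derivative_eq_on[OF J that dg])
    then show ?thesis
      by (auto simp: real_differentiable_def)
  qed
  show ?thesis
  proof (intro bubbly_solution_boost[OF J] ballI)
    fix z assume z: "z \<in> J"
    show "\<rho> differentiable (at z)" "u differentiable (at z)" "deriv u differentiable (at z)"
      "P differentiable (at z)" "P2 differentiable (at z)" "R differentiable (at z)"
      using bspec[OF \<rho> z] Du[OF z] Ddu[OF z] DP[OF z] DP2[OF z] deriv_cube[OF J R0 R3 gd z]
      by (auto simp: real_differentiable_def)
    show "deriv R differentiable (at z)"
      by (rule deriv2_cube[OF J R0 R3 gd gd'[OF z] z])
    show "R z > 0"
      by (rule bspec[OF R0 z])
    show "(1 - X + R z ^ 3) * \<rho> z - 1 = 0"
      using bspec[OF R3 z] bspec[OF \<rho>0 z] by (simp add: field_simps)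
    show "u z * deriv P2 z + 3 * \<gamma> * P2 z * (u z * deriv R z / R z)
        + heat_exchange \<gamma> P0 T0 R0 (P2 z) (R z) = 0"
      using bspec[OF u z] bspec[OF heat z] by simp
  \<comment> \<open>The goals left are the mass, momentum and bubble equations; all terms containing
    \<open>u\<close> or its derivatives drop out.\<close>
  qed (simp_all add: u P2 DERIV_imp_deriv[OF Du] DERIV_imp_deriv[OF Ddu] DERIV_imp_deriv[OF DP])
qed

theorem proposition2p3:
  fixes X \<gamma> \<kappa> P0 T0 R0 c :: real
    and J :: "real set"
    and \<rho>_e u_e P_e P2_e R_e :: "real \<Rightarrow> real"
  assumes "open J" and "is_interval J"
    and "P0 \<noteq> 0" and "R0 \<noteq> 0"
    and equilibrium: "equilibrium_I J X \<gamma> \<kappa> P0 \<rho>_e u_e P_e P2_e R_e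
                      \<or> equilibrium_II J X \<kappa> P0 \<rho>_e u_e P_e P2_e R_e"
    and thermal_balance: "\<forall>x\<in>J. heat_exchange \<gamma> P0 T0 R0 (P2_e x) (R_e x) = 0"
  shows "bubbly_solution X \<gamma> \<kappa> P0 T0 R0 {(x, t). x - c * t \<in> J}
           (\<lambda>x t. \<rho>_e (x - c * t))
           (\<lambda>x t. u_e (x - c * t) + c)
           (\<lambda>x t. P_e (x - c * t))
           (\<lambda>x t. P2_e (x - c * t))
           (\<lambda>x t. R_e (x - c * t))"
  using equilibrium
proof
  assume "equilibrium_I J X \<gamma> \<kappa> P0 \<rho>_e u_e P_e P2_e R_e"
  then show ?thesis
    by (rule equilibrium_I_boost[OF \<open>open J\<close> _ thermal_balance])
next
  assume "equilibrium_II J X \<kappa> P0 \<rho>_e u_e P_e P2_e R_e"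
  then show ?thesis
    by (rule equilibrium_II_boost[OF \<open>open J\<close> _ thermal_balance])
qed

end
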